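(* Let $d\ge 3$ be an integer, $\mu>0$, and let $\gamma(s)=(t(s),r(s),\chi_1(s),\dots,\chi_{d-1}(s))$ be a geodesic of the Tangherlini metric $g_T$ contained in the region $r^{d-2}>\mu$, with $\chi_i(s)=\frac{\pi}{2}$ for all $i>1$ and all $s$. Write a dot for $d/ds$. Then the quantities $$E:=\left(1-\frac{\mu}{r^{d-2}}\right)\dot t,\qquad L:=r^2\dot\chi_1$$ are constant along $\gamma$. Moreover: (1) If $\gamma$ is timelike and parametrized by proper time, i.e. $g_T(\dot\gamma,\dot\gamma)=-1$, then $$E^2=\dot r^2+V(r),\qquad V(r)=\left(\frac{L^2}{r^2}+1\right)\left(1-\frac{\mu}{r^{d-2}}\right).$$ (2) If $\gamma$ is lightlike, i.e. $g_T(\dot\gamma,\dot\gamma)=0$, then $$E^2=\dot r^2+\tilde V(r),\qquad \tilde V(r)=\frac{L^2}{r^2}\left(1-\frac{\mu}{r^{d-2}}\right).$$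
   Context: The Tangherlini metric is $$g_T=-\left(1-\frac{\mu}{r^{d-2}}\right)dt^2+\frac{1}{1-\frac{\mu}{r^{d-2}}}dr^2+r^2 g_{S^{d-1}},$$ where the round metric on the unit sphere $S^{d-1}$ in spherical coordinates $\chi_1,\dots,\chi_{d-1}$ is $$g_{S^{d-1}}=\sum_{k=1}^{d-1}\left(\prod_{s=1}^{k-1}\sin^2\chi_s\right)d\chi_k\otimes d\chi_k,$$ with the empty product equal to $1$. *)

theory Defs
  imports "HOL-Analysis.Analysis"
begin

section \<open>Geodesics of a metric given in coordinates\<close>

text \<open>
  Coordinates are labelled by a finite set \<open>J\<close> of indices; a point is its coordinate function and
  \<open>g x i j\<close> is the component \<open>g\<^sub>i\<^sub>j\<close> at the point \<open>x\<close>.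
\<close>

type_synonym 'i metric = "('i \<Rightarrow> real) \<Rightarrow> 'i \<Rightarrow> 'i \<Rightarrow> real"

definition partial :: "'i \<Rightarrow> (('i \<Rightarrow> real) \<Rightarrow> real) \<Rightarrow> ('i \<Rightarrow> real) \<Rightarrow> real" where
  "partial i F x = deriv (\<lambda>h. F (x(i := h))) (x i)"

definition velocity :: "(real \<Rightarrow> 'i \<Rightarrow> real) \<Rightarrow> real \<Rightarrow> 'i \<Rightarrow> real" where
  "velocity c s i = deriv (\<lambda>u. c u i) s"

definition metric_apply :: "'i set \<Rightarrow> 'i metric \<Rightarrow> ('i \<Rightarrow> real) \<Rightarrow> ('i \<Rightarrow> real) \<Rightarrow> ('i \<Rightarrow> real) \<Rightarrow> real" where
  "metric_apply J g x v w = (\<Sum>i\<in>J. \<Sum>j\<in>J. g x i j * v i * w j)"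

text \<open>
  \<open>christoffel1 g x k i j\<close> is the Christoffel symbol of the first kind, that is
  \<open>g(\<nabla>\<^sub>i \<partial>\<^sub>j, \<partial>\<^sub>k)\<close> for the Levi-Civita connection.
\<close>

definition christoffel1 :: "'i metric \<Rightarrow> ('i \<Rightarrow> real) \<Rightarrow> 'i \<Rightarrow> 'i \<Rightarrow> 'i \<Rightarrow> real" where
  "christoffel1 g x k i j =
     (partial i (\<lambda>y. g y j k) x + partial j (\<lambda>y. g y i k) x - partial k (\<lambda>y. g y i j) x) / 2"

text \<open>
  The equation below says that \<open>g(\<nabla>\<^sub>v v, \<partial>\<^sub>k) = 0\<close> for all \<open>k\<close>, where \<open>v\<close> is the velocity of \<open>c\<close>.
  Wherever \<open>g\<close> is nondegenerate this is the usual geodesic equation (lemma \<open>geodesic_eq_iff\<close>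
  below).  Keeping the index lowered lets the equation make sense also where a coordinate system
  degenerates, as spherical coordinates do at the poles of the sphere: for a curve through such a
  point it is the pullback of the geodesic equation of the underlying manifold.
\<close>

definition geodesic_eq :: "'i set \<Rightarrow> 'i metric \<Rightarrow> (real \<Rightarrow> 'i \<Rightarrow> real) \<Rightarrow> real \<Rightarrow> bool" where
  "geodesic_eq J g c s \<longleftrightarrow>
     (\<forall>k\<in>J. (\<Sum>j\<in>J. g (c s) k j * deriv (\<lambda>u. velocity c u j) s)
           + (\<Sum>i\<in>J. \<Sum>j\<in>J. christoffel1 g (c s) k i j * velocity c s i * velocity c s j) = 0)"

definition geodesic_on :: "real set \<Rightarrow> 'i set \<Rightarrow> 'i metric \<Rightarrow> (real \<Rightarrow> 'i \<Rightarrow> real) \<Rightarrow> bool" where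
  "geodesic_on I J g c \<longleftrightarrow>
     (\<forall>s\<in>I. (\<forall>k\<in>J. (\<lambda>u. c u k) differentiable (at s) \<and> (\<lambda>u. velocity c u k) differentiable (at s))
           \<and> geodesic_eq J g c s)"

definition christoffel2 ::
    "'i set \<Rightarrow> ('i \<Rightarrow> 'i \<Rightarrow> real) \<Rightarrow> 'i metric \<Rightarrow> ('i \<Rightarrow> real) \<Rightarrow> 'i \<Rightarrow> 'i \<Rightarrow> 'i \<Rightarrow> real" where
  "christoffel2 J ginv g x k i j = (\<Sum>l\<in>J. ginv k l * christoffel1 g x l i j)"

lemma geodesic_eq_iff:
  assumes J: "finite J"
    and left: "\<And>k l. k \<in> J \<Longrightarrow> l \<in> J \<Longrightarrow> (\<Sum>m\<in>J. ginv k m * g (c s) m l) = (if k = l then 1 else 0)"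
    and right: "\<And>k l. k \<in> J \<Longrightarrow> l \<in> J \<Longrightarrow> (\<Sum>m\<in>J. g (c s) k m * ginv m l) = (if k = l then 1 else 0)"
  shows "geodesic_eq J g c s \<longleftrightarrow>
     (\<forall>k\<in>J. deriv (\<lambda>u. velocity c u k) s
           + (\<Sum>i\<in>J. \<Sum>j\<in>J. christoffel2 J ginv g (c s) k i j * velocity c s i * velocity c s j) = 0)"
proof -
  define a where "a = (\<lambda>j. deriv (\<lambda>u. velocity c u j) s)"
  define q where "q = (\<lambda>k. \<Sum>i\<in>J. \<Sum>j\<in>J. christoffel1 g (c s) k i j * velocity c s i * velocity c s j)"
  have q2: "(\<Sum>i\<in>J. \<Sum>j\<in>J. christoffel2 J ginv g (c s) k i j * velocity c s i * velocity c s j)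
      = (\<Sum>l\<in>J. ginv k l * q l)" for k
  proof -
    have "(\<Sum>i\<in>J. \<Sum>j\<in>J. christoffel2 J ginv g (c s) k i j * velocity c s i * velocity c s j)
      = (\<Sum>i\<in>J. \<Sum>j\<in>J. \<Sum>l\<in>J. ginv k l * (christoffel1 g (c s) l i j * velocity c s i * velocity c s j))"
      unfolding christoffel2_def by (simp add: sum_distrib_right mult.assoc)
    also have "\<dots> = (\<Sum>i\<in>J. \<Sum>l\<in>J. \<Sum>j\<in>J. ginv k l * (christoffel1 g (c s) l i j * velocity c s i * velocity c s j))"
      by (intro sum.cong refl sum.swap)
    also have "\<dots> = (\<Sum>l\<in>J. \<Sum>i\<in>J. \<Sum>j\<in>J. ginv k l * (christoffel1 g (c s) l i j * velocity c s i * velocity c s j))"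
      by (rule sum.swap)
    finally show ?thesis unfolding q_def by (simp add: sum_distrib_left)
  qed
  have contract: "(\<Sum>m\<in>J. A k m * (\<Sum>l\<in>J. B m l * v l)) = v k"
    if "\<And>l. l \<in> J \<Longrightarrow> (\<Sum>m\<in>J. A k m * B m l) = (if k = l then 1 else 0)" "k \<in> J"
    for A B :: "'a \<Rightarrow> 'a \<Rightarrow> real" and v k
  proof -
    have "(\<Sum>m\<in>J. A k m * (\<Sum>l\<in>J. B m l * v l)) = (\<Sum>m\<in>J. \<Sum>l\<in>J. A k m * B m l * v l)"
      by (simp add: sum_distrib_left mult.assoc)
    also have "\<dots> = (\<Sum>l\<in>J. (\<Sum>m\<in>J. A k m * B m l) * v l)"
      by (subst sum.swap) (simp add: sum_distrib_right)
    also have "\<dots> = (\<Sum>l\<in>J. (if k = l then v l else 0))"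
      using that(1) by (intro sum.cong) auto
    also have "\<dots> = v k" using J that(2) by simp
    finally show ?thesis .
  qed
  have "(\<forall>k\<in>J. (\<Sum>j\<in>J. g (c s) k j * a j) + q k = 0) \<longleftrightarrow> (\<forall>k\<in>J. a k + (\<Sum>l\<in>J. ginv k l * q l) = 0)"
    (is "?low \<longleftrightarrow> ?up")
  proof
    assume low: ?low
    show ?up
    proof
      fix k assume k: "k \<in> J"
      have "0 = (\<Sum>m\<in>J. ginv k m * ((\<Sum>j\<in>J. g (c s) m j * a j) + q m))" using low by simp
      also have "\<dots> = a k + (\<Sum>l\<in>J. ginv k l * q l)"
        using contract[of ginv k "g (c s)" a] left k by (simp add: distrib_left sum.distrib)
      finally show "a k + (\<Sum>l\<in>J. ginv k l * q l) = 0" by simp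
    qed
  next
    assume up: ?up
    show ?low
    proof
      fix k assume k: "k \<in> J"
      have "0 = (\<Sum>m\<in>J. g (c s) k m * (a m + (\<Sum>l\<in>J. ginv m l * q l)))" using up by simp
      also have "\<dots> = (\<Sum>j\<in>J. g (c s) k j * a j) + q k"
        using contract[of "g (c s)" k ginv q] right k by (simp add: distrib_left sum.distrib)
      finally show "(\<Sum>j\<in>J. g (c s) k j * a j) + q k = 0" by simp
    qed
  qed
  then show ?thesis unfolding geodesic_eq_def q2 a_def q_def by simp
qed


section \<open>The Tangherlini metric\<close>

datatype coord = Time | Radius | Angle nat

definition coords :: "nat \<Rightarrow> coord set" where
  "coords d = {Time, Radius} \<union> Angle ` {1..d - 1}"

definition sphere_metric :: "nat metric" where
  "sphere_metric chi k l = (if k = l then (\<Prod>s\<in>{1..<k}. (sin (chi s))\<^sup>2) else 0)"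

definition static_factor :: "nat \<Rightarrow> real \<Rightarrow> real \<Rightarrow> real" where
  "static_factor d \<mu> r = 1 - \<mu> / r ^ (d - 2)"

fun tangherlini :: "nat \<Rightarrow> real \<Rightarrow> coord metric" where
  "tangherlini d \<mu> x Time Time = - static_factor d \<mu> (x Radius)"
| "tangherlini d \<mu> x Radius Radius = 1 / static_factor d \<mu> (x Radius)"
| "tangherlini d \<mu> x (Angle k) (Angle l) = (x Radius)\<^sup>2 * sphere_metric (\<lambda>s. x (Angle s)) k l"
| "tangherlini d \<mu> x _ _ = 0"

fun curve :: "(real \<Rightarrow> real) \<Rightarrow> (real \<Rightarrow> real) \<Rightarrow> (nat \<Rightarrow> real \<Rightarrow> real) \<Rightarrow> real \<Rightarrow> coord \<Rightarrow> real" where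
  "curve t r chi s Time = t s"
| "curve t r chi s Radius = r s"
| "curve t r chi s (Angle k) = chi k s"

definition energy :: "nat \<Rightarrow> real \<Rightarrow> (real \<Rightarrow> real) \<Rightarrow> (real \<Rightarrow> real) \<Rightarrow> real \<Rightarrow> real" where
  "energy d \<mu> t r s = static_factor d \<mu> (r s) * deriv t s"

definition angular_momentum :: "(real \<Rightarrow> real) \<Rightarrow> (nat \<Rightarrow> real \<Rightarrow> real) \<Rightarrow> real \<Rightarrow> real" where
  "angular_momentum r chi s = (r s)\<^sup>2 * deriv (chi 1) s"

definition timelike_potential :: "nat \<Rightarrow> real \<Rightarrow> real \<Rightarrow> real \<Rightarrow> real" where
  "timelike_potential d \<mu> L r = (L\<^sup>2 / r\<^sup>2 + 1) * static_factor d \<mu> r"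

definition lightlike_potential :: "nat \<Rightarrow> real \<Rightarrow> real \<Rightarrow> real \<Rightarrow> real" where
  "lightlike_potential d \<mu> L r = L\<^sup>2 / r\<^sup>2 * static_factor d \<mu> r"

end

theory Submission
  imports Defs
begin

text \<open>
  Neither \<open>t\<close> nor \<open>\<chi>\<^sub>1\<close> enters the metric coefficients of the directions in which the curve moves:
  the coefficients of \<open>\<chi>\<^sub>2, \<dots>, \<chi>\<^sub>d\<^sub>-\<^sub>1\<close> do depend on \<open>\<chi>\<^sub>1\<close>, but these angles stay at \<open>\<pi>/2\<close>, so their
  velocities vanish.  For such a coordinate \<open>k\<close> of a diagonal metric the geodesic equation says that
  the momentum \<open>g\<^sub>k\<^sub>k v\<^sup>k\<close> has derivative zero; for \<open>t\<close> and \<open>\<chi>\<^sub>1\<close> these momenta are \<open>-E\<close> and \<open>L\<close>.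
  The radial equations are the normalization of the velocity multiplied by the static factor.
\<close>

lemma partial_const [simp]: "partial i (\<lambda>y. c) x = 0"
  by (simp add: partial_def)

text \<open>In \<open>christoffel1 g x k i j\<close> the first two terms survive only for
  \<open>j = k\<close> and \<open>i = k\<close> respectively; each contributes half of the
  derivative of \<open>g x k k\<close> along the curve. The third term survives only for
  \<open>i = j\<close>, and \<open>cyclic\<close> removes it. By the chain rule the resulting left
  side is the derivative of \<open>g (c s) k k * velocity c s k\<close>.\<close>

lemma geodesic_eq_diagonal:
  assumes J: "finite J" "k \<in> J"
    and diag: "\<And>x i j. i \<noteq> j \<Longrightarrow> g x i j = 0"
    and geo: "geodesic_eq J g c s"
    and cyclic: "\<And>i. i \<in> J \<Longrightarrow> velocity c s i = 0 \<or> partial k (\<lambda>y. g y i i) (c s) = 0"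
  shows "g (c s) k k * deriv (\<lambda>u. velocity c u k) s
    + (\<Sum>i\<in>J. partial i (\<lambda>y. g y k k) (c s) * velocity c s i) * velocity c s k = 0"
proof -
  define v where "v = velocity c s"
  define p where "p = (\<lambda>i. partial i (\<lambda>y. g y k k) (c s))"
  have off: "partial l (\<lambda>y. g y i j) (c s) = 0" if "i \<noteq> j" for l i j
    using that by (simp add: diag)
  have p: "partial i (\<lambda>y. g y j k) (c s) = (if j = k then p i else 0)" for i j
    by (simp add: off p_def)
  have cyc: "partial k (\<lambda>y. g y i j) (c s) * v i * v j = 0" if "i \<in> J" for i j
    using cyclic[OF that] off[of i j k] by (cases "i = j") (auto simp: v_def)
  have summand: "christoffel1 g (c s) k i j * v i * v j
      = (if j = k then p i * v i * v k / 2 else 0) + (if i = k then p j * v j * v k / 2 else 0)"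
    if "i \<in> J" for i j
  proof -
    have "christoffel1 g (c s) k i j * v i * v j
        = ((if j = k then p i else 0) + (if i = k then p j else 0)) / 2 * v i * v j
          - partial k (\<lambda>y. g y i j) (c s) * v i * v j / 2"
      by (simp add: christoffel1_def p field_simps)
    then show ?thesis using cyc[OF that, of j] by (auto simp: field_simps)
  qed
  have "(\<Sum>i\<in>J. \<Sum>j\<in>J. christoffel1 g (c s) k i j * v i * v j)
      = (\<Sum>i\<in>J. p i * v i * v k / 2 + (if i = k then \<Sum>j\<in>J. p j * v j * v k / 2 else 0))"
    by (intro sum.cong refl) (simp add: summand sum.distrib J)
  \<comment> \<open>The halves coming from \<open>j = k\<close> and from \<open>i = k\<close> have
    the same sum, so they add up to one full term.\<close>
  also have "\<dots> = (\<Sum>i\<in>J. p i * v i) * v k"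
    by (simp add: sum.distrib J sum_distrib_right flip: sum_divide_distrib)
  finally have quad: "(\<Sum>i\<in>J. \<Sum>j\<in>J. christoffel1 g (c s) k i j * v i * v j)
      = (\<Sum>i\<in>J. p i * v i) * v k" .
  have "(\<Sum>j\<in>J. g (c s) k j * deriv (\<lambda>u. velocity c u j) s)
      = (\<Sum>j\<in>J. if j = k then g (c s) k k * deriv (\<lambda>u. velocity c u k) s else 0)"
    by (intro sum.cong refl) (auto simp: diag)
  then have lin: "(\<Sum>j\<in>J. g (c s) k j * deriv (\<lambda>u. velocity c u j) s)
      = g (c s) k k * deriv (\<lambda>u. velocity c u k) s"
    using J by simp
  show ?thesis
    using geo J(2) unfolding geodesic_eq_def
    by (auto simp: lin quad[unfolded v_def p_def] p_def v_def)
qed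

lemma sum_coords_equatorial:
  assumes "d \<ge> 3" and "\<And>k. 1 < k \<Longrightarrow> k \<le> d - 1 \<Longrightarrow> F (Angle k) = 0"
  shows "(\<Sum>i\<in>coords d. F i) = F Time + F Radius + F (Angle 1)"
proof -
  have "(\<Sum>i\<in>coords d. F i) = (\<Sum>i\<in>{Time, Radius, Angle 1}. F i)"
  proof (intro sum.mono_neutral_right ballI)
    show "F i = 0" if "i \<in> coords d - {Time, Radius, Angle 1}" for i
      using that assms(2) by (cases i) (auto simp: coords_def)
  qed (use assms(1) in \<open>auto simp: coords_def\<close>)
  then show ?thesis by (simp add: add.assoc)
qed

lemma tangherlini_diagonal:
  assumes "i \<noteq> j"
  shows "tangherlini d \<mu> x i j = 0"
  using assms by (cases i; cases j) (auto simp: sphere_metric_def)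

lemma has_derivative_zero_imp_constant_on:
  fixes f :: "real \<Rightarrow> real"
  assumes "is_interval I" and "\<And>s. s \<in> I \<Longrightarrow> (f has_real_derivative 0) (at s)"
  shows "f constant_on I"
  using has_field_derivative_zero_constant[of I f] assms
  by (auto simp: constant_on_def is_interval_convex intro: has_field_derivative_at_within)

theorem mainTheorem2:
  fixes d :: nat and \<mu> :: real and I :: "real set"
    and t r :: "real \<Rightarrow> real" and chi :: "nat \<Rightarrow> real \<Rightarrow> real"
  defines "\<gamma> \<equiv> curve t r chi"
    and "E \<equiv> energy d \<mu> t r"
    and "L \<equiv> angular_momentum r chi"
  assumes "d \<ge> 3" and "\<mu> > 0"
    and "open I" and "is_interval I"
    and "geodesic_on I (coords d) (tangherlini d \<mu>) \<gamma>"
    and "\<forall>s\<in>I. r s ^ (d - 2) > \<mu>"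
    and "\<forall>s\<in>I. \<forall>i. 1 < i \<and> i \<le> d - 1 \<longrightarrow> chi i s = pi / 2"
  shows "E constant_on I \<and> L constant_on I
    \<and> ((\<forall>s\<in>I. metric_apply (coords d) (tangherlini d \<mu>) (\<gamma> s) (velocity \<gamma> s) (velocity \<gamma> s) = - 1) \<longrightarrow>
         (\<forall>s\<in>I. (E s)\<^sup>2 = (deriv r s)\<^sup>2 + timelike_potential d \<mu> (L s) (r s)))
    \<and> ((\<forall>s\<in>I. metric_apply (coords d) (tangherlini d \<mu>) (\<gamma> s) (velocity \<gamma> s) (velocity \<gamma> s) = 0) \<longrightarrow>
         (\<forall>s\<in>I. (E s)\<^sup>2 = (deriv r s)\<^sup>2 + lightlike_potential d \<mu> (L s) (r s)))"
proof -
  note d = \<open>d \<ge> 3\<close> and E_def = \<open>E \<equiv> _\<close> and L_def = \<open>L \<equiv> _\<close>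
  let ?f = "static_factor d \<mu>" and ?g = "tangherlini d \<mu>" and ?v = "velocity \<gamma>"
  have fin: "finite (coords d)"
    and mem: "Time \<in> coords d" "Radius \<in> coords d" "Angle 1 \<in> coords d"
    using d by (auto simp: coords_def)
  have \<gamma>: "\<gamma> s Time = t s" "\<gamma> s Radius = r s" "\<gamma> s (Angle k) = chi k s" for s k
    by (auto simp: assms(1))
  have v: "?v s Time = deriv t s" "?v s Radius = deriv r s" "?v s (Angle k) = deriv (chi k) s" for s k
    by (auto simp: velocity_def \<gamma>)
  have v0: "?v s (Angle k) = 0" if "s \<in> I" "1 < k" "k \<le> d - 1" for s k
  proof -
    \<comment> \<open>Since \<open>I\<close> is open, the angle is constant on a whole neighbourhood
      of \<open>s\<close>, which is what its derivative at \<open>s\<close> depends on.\<close>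
    have "\<forall>\<^sub>F u in nhds s. chi k u = pi / 2"
      using assms(6,10) that by (auto simp: eventually_nhds)
    then have "deriv (chi k) s = deriv (\<lambda>u. pi / 2) s" by (intro deriv_cong_ev) auto
    then show ?thesis by (simp add: v)
  qed
  have geo: "geodesic_eq (coords d) ?g \<gamma> s" if "s \<in> I" for s
    using assms(8) that by (simp add: geodesic_on_def)
  have D: "((\<lambda>u. \<gamma> u k) has_real_derivative ?v s k) (at s)"
    "((\<lambda>u. ?v u k) has_real_derivative deriv (\<lambda>u. ?v u k) s) (at s)"
    if "s \<in> I" "k \<in> coords d" for s k
    using assms(8) that
    by (auto simp: geodesic_on_def velocity_def DERIV_deriv_iff_real_differentiable)
  have pos: "r s ^ (d - 2) > 0" if "s \<in> I" for s
    using assms(5,9) that by force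
  \<comment> \<open>As \<open>d - 2\<close> is positive, \<open>r s = 0\<close> would make the power
    vanish. The sign of \<open>r s\<close> stays open: for even \<open>d\<close> a negative value
    also has a positive power.\<close>
  have r0: "r s \<noteq> 0" if "s \<in> I" for s
    using pos[OF that] d by (auto simp: zero_power)
  have f0: "?f (r s) \<noteq> 0" if "s \<in> I" for s
    using pos[OF that] assms(9) that by (auto simp: static_factor_def)
  \<comment> \<open>The value of this derivative is left unevaluated: it enters the geodesic
    equation and the derivative of \<open>E\<close> in the same way.\<close>
  have f': "(?f has_real_derivative deriv ?f (r s)) (at (r s))" if "s \<in> I" for s
    unfolding DERIV_deriv_iff_real_differentiable static_factor_def
    using r0[OF that] by (intro derivative_intros) auto

  have E: "E constant_on I"
  proof (rule has_derivative_zero_imp_constant_on[OF assms(7)])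
    fix s assume s: "s \<in> I"
    have g': "partial Radius (\<lambda>y. ?g y Time Time) (\<gamma> s) = - deriv ?f (r s)"
      using DERIV_imp_deriv[OF DERIV_minus[OF f'[OF s]]] by (simp add: partial_def \<gamma>)
    have g0: "partial i (\<lambda>y. ?g y Time Time) (\<gamma> s) = 0" if "i \<noteq> Radius" for i
      using that by (simp add: partial_def)
    have "partial Time (\<lambda>y. ?g y i i) (\<gamma> s) = 0" for i
      by (cases i) (simp_all add: partial_def sphere_metric_def)
    then have "?g (\<gamma> s) Time Time * deriv (\<lambda>u. ?v u Time) s
        + (\<Sum>i\<in>coords d. partial i (\<lambda>y. ?g y Time Time) (\<gamma> s) * ?v s i) * ?v s Time = 0"
      by (intro geodesic_eq_diagonal fin mem geo s tangherlini_diagonal) auto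
    \<comment> \<open>This is the negative of the \<open>Time\<close> equation. The coefficient of
      \<open>Time\<close> depends on the radius alone, so one term of the sum remains.\<close>
    then have eq: "?f (r s) * deriv (\<lambda>u. deriv t u) s + deriv ?f (r s) * deriv r s * deriv t s = 0"
      using d by (subst (asm) sum_coords_equatorial) (auto simp: v0 s g'[simplified] g0[simplified] v \<gamma>)
    have "((\<lambda>u. ?f (r u) * deriv t u) has_real_derivative
        deriv ?f (r s) * deriv r s * deriv t s + deriv (\<lambda>u. deriv t u) s * ?f (r s)) (at s)"
      using D[OF s mem(1)] D[OF s mem(2)]
      by (intro DERIV_mult DERIV_chain2[where f = ?f and g = r, OF f'[OF s]]) (simp_all add: v \<gamma>)
    then show "(E has_real_derivative 0) (at s)"
      using eq by (simp add: E_def energy_def[abs_def] algebra_simps)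
  qed

  have L: "L constant_on I"
  proof (rule has_derivative_zero_imp_constant_on[OF assms(7)])
    fix s assume s: "s \<in> I"
    let ?a = "Angle (1::nat)"
    \<comment> \<open>For the first angle the product of squared sines is empty.\<close>
    have g: "(\<lambda>y. ?g y ?a ?a) = (\<lambda>y. (y Radius)\<^sup>2)"
      by (simp add: sphere_metric_def)
    have "((\<lambda>x::real. x\<^sup>2) has_real_derivative 2 * r s) (at (r s))"
      by (auto intro!: derivative_eq_intros)
    then have g': "partial Radius (\<lambda>y. ?g y ?a ?a) (\<gamma> s) = 2 * r s"
      unfolding g by (simp add: partial_def \<gamma> DERIV_imp_deriv)
    have g0: "partial i (\<lambda>y. ?g y ?a ?a) (\<gamma> s) = 0" if "i \<noteq> Radius" for i
      using that unfolding g by (simp add: partial_def)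
    \<comment> \<open>Angles with index above 1 satisfy the first alternative, all other coordinates
      the second.\<close>
    have cyclic: "?v s i = 0 \<or> partial ?a (\<lambda>y. ?g y i i) (\<gamma> s) = 0" if "i \<in> coords d" for i
    proof (cases i)
      case (Angle k)
      then show ?thesis
        using that v0[OF s, of k] g0[of ?a] by (cases "k = 1") (auto simp: coords_def)
    qed (simp_all add: partial_def)
    have "?g (\<gamma> s) ?a ?a * deriv (\<lambda>u. ?v u ?a) s
        + (\<Sum>i\<in>coords d. partial i (\<lambda>y. ?g y ?a ?a) (\<gamma> s) * ?v s i) * ?v s ?a = 0"
      using cyclic by (intro geodesic_eq_diagonal fin mem geo s tangherlini_diagonal) auto
    then have eq: "(r s)\<^sup>2 * deriv (\<lambda>u. deriv (chi 1) u) s + 2 * r s * deriv r s * deriv (chi 1) s = 0"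
      using d by (subst (asm) sum_coords_equatorial)
        (simp_all del: tangherlini.simps add: v0 s g'[unfolded One_nat_def] g0[unfolded One_nat_def] v \<gamma> fun_cong[OF g, of "\<gamma> s", unfolded One_nat_def])
    have "((\<lambda>u. (r u)\<^sup>2 * deriv (chi 1) u) has_real_derivative
        2 * r s * deriv r s * deriv (chi 1) s + deriv (\<lambda>u. deriv (chi 1) u) s * (r s)\<^sup>2) (at s)"
      using D[OF s mem(3)] D[OF s mem(2)]
      by (intro DERIV_mult) (auto simp: v \<gamma> intro!: derivative_eq_intros)
    then show "(L has_real_derivative 0) (at s)"
      using eq by (simp add: L_def angular_momentum_def[abs_def] algebra_simps)
  qed

  \<comment> \<open>Both causal types at once: \<open>N\<close> is -1 for timelike and 0 for
    lightlike curves.\<close>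
  have norm: "(E s)\<^sup>2 = (deriv r s)\<^sup>2 + ((L s)\<^sup>2 / (r s)\<^sup>2 - N) * ?f (r s)"
    if s: "s \<in> I" and N: "metric_apply (coords d) ?g (\<gamma> s) (?v s) (?v s) = N" for s N
  proof -
    have "metric_apply (coords d) ?g (\<gamma> s) (?v s) (?v s)
        = (\<Sum>i\<in>coords d. \<Sum>j\<in>coords d. if j = i then ?g (\<gamma> s) i i * (?v s i)\<^sup>2 else 0)"
      unfolding metric_apply_def
      by (intro sum.cong refl) (auto simp: tangherlini_diagonal power2_eq_square)
    also have "\<dots> = (\<Sum>i\<in>coords d. ?g (\<gamma> s) i i * (?v s i)\<^sup>2)"
      using fin by simp
    also have "\<dots> = - ?f (r s) * (deriv t s)\<^sup>2 + (deriv r s)\<^sup>2 / ?f (r s) + (r s)\<^sup>2 * (deriv (chi 1) s)\<^sup>2"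
      using d by (subst sum_coords_equatorial) (simp_all add: v0[unfolded v] s v \<gamma> sphere_metric_def)
    finally have "N = \<dots>" using N by simp
    then show ?thesis
      using f0[OF s] r0[OF s]
      by (simp add: E_def L_def energy_def angular_momentum_def field_simps power2_eq_square)
  qed
  show ?thesis
    using E L norm by (auto simp: timelike_potential_def lightlike_potential_def)
qed

end
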